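(* Fix $\bar e\ge 0$ and $\bar\theta\in\mathbb R$ with $1+\bar e\cos\bar\theta>0$. For $\sigma\in\{+2,0,-2\}$ define, for $\beta\in[0,2\pi)$ with $1-3\cos^2\beta\ge 0$, $$\Psi_\sigma(\bar e,\bar\theta,\beta)=2\cos\beta\sin\beta\left(-1+\sigma\sqrt{\frac{1-3\cos^2\beta}{1+\bar e\cos\bar\theta}}\right)-(1-3\cos^2\beta)\frac{\bar e\sin\bar\theta}{1+\bar e\cos\bar\theta}.$$ Then the equation $\Psi(\bar e,\bar\theta,\beta)=0$, meaning the three equations $\Psi_\sigma(\bar e,\bar\theta,\beta)=0$, $\sigma\in\{2,0,-2\}$, taken together, has at least $6$ and at most $10$ zeros $\beta\in[0,2\pi)$; that is, the total number of pairs $(\sigma,\beta)$ with $\Psi_\sigma(\bar e,\bar\theta,\beta)=0$ is at least $6$ and at most $10$.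
   Context: The function $\Psi$ is $$\Psi(e,\theta,\beta)=2\cos\beta\sin\beta\left(-1\pm\sqrt{\tfrac{1-3\cos^2\beta}{1+e\cos\theta}}\mp\sqrt{\tfrac{1-3\cos^2\beta}{1+e\cos\theta}}\right)-(1-3\cos^2\beta)\tfrac{e\sin\theta}{1+e\cos\theta},$$ where the two signs in front of the square roots are chosen independently. The four sign choices give three distinct functions: both signs positive ($\sigma=2$), opposite signs ($\sigma=0$), both signs negative ($\sigma=-2$). Here $e$ is an orbital eccentricity, $\theta$ a true anomaly, and $\beta$ an angle; the function is defined only where $1-3\cos^2\beta\ge0$. *)

theory Defs
  imports Complex_Main
begin

text \<open>
  The parameter \<open>\<sigma>\<close> is the sum of the two independently chosen signs in front of the two equal
  square roots, hence \<open>\<sigma> \<in> {2, 0, -2}\<close>. HOL's \<open>sqrt\<close> is total (and odd), so the condition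
  \<open>1 - 3 * (cos \<beta>)\<^sup>2 \<ge> 0\<close> under which \<open>Psi\<close> is meaningful has to be imposed separately, as is done
  in \<open>Psi_zeros\<close>.
\<close>

definition Psi :: "real \<Rightarrow> real \<Rightarrow> real \<Rightarrow> real \<Rightarrow> real" where
  "Psi \<sigma> e \<theta> \<beta> =
     2 * cos \<beta> * sin \<beta> * (- 1 + \<sigma> * sqrt ((1 - 3 * (cos \<beta>)\<^sup>2) / (1 + e * cos \<theta>)))
     - (1 - 3 * (cos \<beta>)\<^sup>2) * (e * sin \<theta> / (1 + e * cos \<theta>))"

text \<open>
  Zeros are pairs \<open>(\<sigma>, \<beta>)\<close>: an angle solving the equation for several values of \<open>\<sigma>\<close> counts
  once for each of them.
\<close>

definition Psi_zeros :: "real \<Rightarrow> real \<Rightarrow> (real \<times> real) set" where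
  "Psi_zeros e \<theta> =
     {(\<sigma>, \<beta>). \<sigma> \<in> {2, 0, -2} \<and> \<beta> \<in> {0..<2 * pi} \<and> 1 - 3 * (cos \<beta>)\<^sup>2 \<ge> 0 \<and> Psi \<sigma> e \<theta> \<beta> = 0}"

end

theory Submission
  imports Defs
begin

text \<open>
  Where \<open>1 - 3 * (cos \<beta>)\<^sup>2 \<ge> 0\<close> the sine does not vanish, and \<open>\<Psi>\<^sub>\<sigma>\<close> divided by \<open>(sin \<beta>)\<^sup>2\<close> is a
  function of \<open>t = cot \<beta>\<close> alone on \<open>2 * t\<^sup>2 \<le> 1\<close>; every \<open>t\<close> comes from exactly two angles. This
  function has opposite signs at the two end points, so each \<open>\<sigma>\<close> contributes at least one \<open>t\<close>.
  Dividing by \<open>1 - 2 * t\<^sup>2\<close> isolates the constant \<open>e * sin \<theta> / (1 + e * cos \<theta>)\<close>; the derivative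
  of the remaining odd function has no zero for \<open>\<sigma> \<le> 0\<close> and, being governed by an equation in \<open>t\<^sup>2\<close>
  with at most one solution, at most two zeros for \<open>\<sigma> > 0\<close>. By Rolle there are at most
  \<open>3 + 1 + 1\<close> values of \<open>t\<close> in total.
\<close>

section \<open>Rolle's theorem as a bound on level sets\<close>

text \<open>Between each point of \<open>S\<close> other than the largest and its successor in
  \<open>S\<close>, Rolle yields a critical point, and these are distinct. Treating finite subsets
  first avoids presupposing that the level set is finite.\<close>

lemma card_le_Suc_card_critical_points:
  fixes f f' :: "real \<Rightarrow> real"
  assumes deriv: "\<And>x. a < x \<Longrightarrow> x < b \<Longrightarrow> (f has_real_derivative f' x) (at x)"
    and fin: "finite {x \<in> {a<..<b}. f' x = 0}"
    and S: "finite S" "S \<subseteq> {x \<in> {a<..<b}. f x = c}"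
  shows "card S \<le> Suc (card {x \<in> {a<..<b}. f' x = 0})"
proof (cases "S = {}")
  case False
  let ?S' = "S - {Max S}" and ?C = "{x \<in> {a<..<b}. f' x = 0}"
  \<comment> \<open>Requiring \<open>y\<close> to lie below all later points of \<open>S\<close> is
    what makes the choice \<open>g\<close> injective.\<close>
  have ex: "\<exists>y\<in>?C. x < y \<and> (\<forall>z\<in>S. x < z \<longrightarrow> y < z)" if x: "x \<in> ?S'" for x
  proof -
    let ?U = "{z \<in> S. x < z}"
    have "x < Max S" using x S by (metis DiffE Max_ge insertI1 order_le_less)
    then have U: "finite ?U" "?U \<noteq> {}" using S(1) False Max_in by auto
    let ?z = "Min ?U"
    have z: "?z \<in> S" "x < ?z" using Min_in[OF U] by auto
    have ab: "a < x" "x < b" "a < ?z" "?z < b" "f x = f ?z" using S(2) x z by auto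
    have "\<exists>l>x. l < ?z \<and> DERIV f l :> 0"
    proof (rule Rolle)
      show "continuous_on {x..?z} f"
        using ab by (intro continuous_at_imp_continuous_on ballI DERIV_isCont[OF deriv]) auto
      show "f differentiable (at u)" if "x < u" "u < ?z" for u
        using deriv[of u] ab that by (auto simp: real_differentiable_def)
    qed (use z ab in auto)
    then obtain y where y: "x < y" "y < ?z" "DERIV f y :> 0" by blast
    then have "y \<in> ?C" using ab deriv[of y] DERIV_unique by fastforce
    moreover have "y < w" if "w \<in> S" "x < w" for w
      using y(2) Min_le[OF U(1), of w] that by auto
    ultimately show ?thesis using y(1) by blast
  qed
  then obtain g where g: "\<And>x. x \<in> ?S' \<Longrightarrow> g x \<in> ?C \<and> x < g x \<and> (\<forall>z\<in>S. x < z \<longrightarrow> g x < z)"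
    by metis
  have "inj_on g ?S'"
  proof (rule linorder_inj_onI')
    fix x y assume "x \<in> ?S'" "y \<in> ?S'" "x < y"
    then have "g x < y" "y < g y" using g by auto
    then show "g x \<noteq> g y" by linarith
  qed
  then have "card ?S' \<le> card ?C" using g fin by (intro card_inj_on_le[of g]) auto
  then show ?thesis using S(1) by (simp add: card_Diff_singleton_if split: if_splits)
qed simp

text \<open>A uniform bound on the cardinalities of all finite subsets makes the whole set finite
  and bounds it too.\<close>

lemma card_level_set_le_Suc_card_critical_points:
  fixes f f' :: "real \<Rightarrow> real"
  assumes "\<And>x. a < x \<Longrightarrow> x < b \<Longrightarrow> (f has_real_derivative f' x) (at x)"
    and "finite {x \<in> {a<..<b}. f' x = 0}"
  shows "finite {x \<in> {a<..<b}. f x = c}"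
    and "card {x \<in> {a<..<b}. f x = c} \<le> Suc (card {x \<in> {a<..<b}. f' x = 0})"
proof -
  have "finite {x \<in> {a<..<b}. f x = c} \<and>
      card {x \<in> {a<..<b}. f x = c} \<le> Suc (card {x \<in> {a<..<b}. f' x = 0})"
    using card_le_Suc_card_critical_points[OF assms]
    by (intro finite_if_finite_subsets_card_bdd) blast
  then show "finite {x \<in> {a<..<b}. f x = c}"
    and "card {x \<in> {a<..<b}. f x = c} \<le> Suc (card {x \<in> {a<..<b}. f' x = 0})" by auto
qed

section \<open>Reduction to a level-set problem in the cotangent\<close>

text \<open>
  \<open>cot_Psi\<close> is \<open>Psi\<close> divided by \<open>(sin \<beta>)\<^sup>2\<close> in terms of \<open>t = cot \<beta>\<close>, with
  \<open>s = 1 / sqrt (1 + e * cos \<theta>)\<close> and \<open>k = e * sin \<theta> / (1 + e * cos \<theta>)\<close>.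
\<close>

definition cot_Psi :: "real \<Rightarrow> real \<Rightarrow> real \<Rightarrow> real \<Rightarrow> real" where
  "cot_Psi \<sigma> s k t =
     2 * t * (- 1 + \<sigma> * (s * sqrt ((1 - 2 * t\<^sup>2) / (1 + t\<^sup>2)))) - (1 - 2 * t\<^sup>2) * k"

definition cot_zeros :: "real \<Rightarrow> real \<Rightarrow> real \<Rightarrow> real set" where
  "cot_zeros \<sigma> s k = {t. 2 * t\<^sup>2 \<le> 1 \<and> cot_Psi \<sigma> s k t = 0}"

definition level_fun :: "real \<Rightarrow> real \<Rightarrow> real \<Rightarrow> real" where
  "level_fun \<sigma> s t = 2 * t / (1 - 2 * t\<^sup>2) - 2 * \<sigma> * s * (t / sqrt ((1 - 2 * t\<^sup>2) * (1 + t\<^sup>2)))"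

definition level_fun_deriv :: "real \<Rightarrow> real \<Rightarrow> real \<Rightarrow> real" where
  "level_fun_deriv \<sigma> s t = (2 + 4 * t\<^sup>2) / (1 - 2 * t\<^sup>2)\<^sup>2
     - 2 * \<sigma> * s * ((1 + 2 * t ^ 4) / sqrt ((1 - 2 * t\<^sup>2) * (1 + t\<^sup>2)) ^ 3)"

lemma two_square_less_1_iff:
  fixes t :: real
  shows "2 * t\<^sup>2 < 1 \<longleftrightarrow> t \<in> {- sqrt (1/2)<..<sqrt (1/2)}"
proof -
  have "2 * t\<^sup>2 < 1 \<longleftrightarrow> sqrt (t\<^sup>2) < sqrt (1/2)" unfolding real_sqrt_less_iff by auto
  then show ?thesis unfolding real_sqrt_abs by auto
qed

lemma two_square_eq_1_iff:
  fixes t :: real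
  shows "2 * t\<^sup>2 = 1 \<longleftrightarrow> t = sqrt (1/2) \<or> t = - sqrt (1/2)"
proof -
  have "2 * t\<^sup>2 = 1 \<longleftrightarrow> sqrt (t\<^sup>2) = sqrt (1/2)" unfolding real_sqrt_eq_iff by auto
  then show ?thesis unfolding real_sqrt_abs by (auto simp: abs_if)
qed

lemma level_fun_has_derivative:
  assumes "2 * t\<^sup>2 < 1"
  shows "(level_fun \<sigma> s has_real_derivative level_fun_deriv \<sigma> s t) (at t)"
proof -
  let ?P = "(1 - 2 * t\<^sup>2) * (1 + t\<^sup>2)"
  have P: "?P > 0" using assms by (intro mult_pos_pos) (auto intro: add_pos_nonneg)
  have A: "((\<lambda>t. 2 * t / (1 - 2 * t\<^sup>2)) has_real_derivative (2 + 4 * t\<^sup>2) / (1 - 2 * t\<^sup>2)\<^sup>2) (at t)"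
    using assms
    by (auto intro!: derivative_eq_intros simp: field_simps power2_eq_square)
  have sq: "((\<lambda>t. sqrt ((1 - 2 * t\<^sup>2) * (1 + t\<^sup>2))) has_real_derivative
      (- t - 4 * t ^ 3) / sqrt ?P) (at t)"
    using P by (auto intro!: derivative_eq_intros simp: divide_simps) algebra
  have "((\<lambda>t. t / sqrt ((1 - 2 * t\<^sup>2) * (1 + t\<^sup>2))) has_real_derivative
      (1 * sqrt ?P - t * ((- t - 4 * t ^ 3) / sqrt ?P)) / (sqrt ?P * sqrt ?P)) (at t)"
    using P by (intro DERIV_divide DERIV_ident sq) auto
  \<comment> \<open>The radicand expands to \<open>1 - t\<^sup>2 - 2 * t ^ 4\<close>, so the
    quadratic terms of the numerator cancel and a visibly positive expression remains.\<close>
  moreover have "(1 * sqrt ?P - t * ((- t - 4 * t ^ 3) / sqrt ?P)) / (sqrt ?P * sqrt ?P)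
      = (1 + 2 * t ^ 4) / sqrt ?P ^ 3"
  proof -
    have "1 * sqrt ?P - t * ((- t - 4 * t ^ 3) / sqrt ?P)
        = (sqrt ?P * sqrt ?P - t * (- t - 4 * t ^ 3)) / sqrt ?P"
    proof -
      have "1 * q - t * (a / q) = (q * q - t * a) / q" if "q > 0" for q a :: real
        using that by (simp add: field_simps)
      then show ?thesis using P by simp
    qed
    also have "sqrt ?P * sqrt ?P - t * (- t - 4 * t ^ 3) = 1 + 2 * t ^ 4"
      using P by (simp add: algebra_simps power2_eq_square power3_eq_cube power4_eq_xxxx)
    finally show ?thesis by (simp add: power3_eq_cube)
  qed
  ultimately have B: "((\<lambda>t. t / sqrt ((1 - 2 * t\<^sup>2) * (1 + t\<^sup>2))) has_real_derivative
      (1 + 2 * t ^ 4) / sqrt ?P ^ 3) (at t)" by simp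
  show ?thesis
    unfolding level_fun_def[abs_def] level_fun_deriv_def
    by (intro DERIV_diff A DERIV_cmult B)
qed

lemma cot_Psi_eq_level_fun:
  assumes "2 * t\<^sup>2 < 1"
  shows "cot_Psi \<sigma> s k t = - (1 - 2 * t\<^sup>2) * (level_fun \<sigma> s t + k)"
proof -
  let ?D = "1 - 2 * t\<^sup>2" and ?E = "1 + t\<^sup>2"
  have D: "?D > 0" "?E > 0" using assms by (auto intro: add_pos_nonneg)
  have "sqrt (?D / ?E) = ?D / sqrt (?D * ?E)"
    using D by (simp add: real_sqrt_divide real_sqrt_mult real_div_sqrt divide_simps)
  then have "cot_Psi \<sigma> s k t = 2 * t * (- 1 + \<sigma> * (s * (?D / sqrt (?D * ?E)))) - ?D * k"
    unfolding cot_Psi_def by simp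
  also have "\<dots> = - ?D * (level_fun \<sigma> s t + k)"
  proof -
    have "2 * t * (- 1 + \<sigma> * (s * (d / q))) - d * k
        = - d * (2 * t / d - 2 * \<sigma> * s * (t / q) + k)" if "d > 0" "q > 0" for d q :: real
      using that by (simp add: field_simps)
    from this[of ?D "sqrt (?D * ?E)"] show ?thesis
      using D unfolding level_fun_def by (simp only: mult_pos_pos real_sqrt_gt_zero)
  qed
  finally show ?thesis .
qed

lemma cot_zeros_eq_level_set:
  "cot_zeros \<sigma> s k = {t \<in> {- sqrt (1/2)<..<sqrt (1/2)}. level_fun \<sigma> s t = - k}"
proof -
  \<comment> \<open>At the end points only \<open>- 2 * t\<close> survives, so no root is lost by
    passing to the open interval, where \<open>level_fun\<close> is differentiable.\<close>
  have "cot_Psi \<sigma> s k t \<noteq> 0" if "2 * t\<^sup>2 = 1" for t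
    using that by (auto simp: cot_Psi_def)
  then have "cot_zeros \<sigma> s k = {t. 2 * t\<^sup>2 < 1 \<and> cot_Psi \<sigma> s k t = 0}"
    unfolding cot_zeros_def by (auto simp: order_le_less)
  also have "\<dots> = {t. 2 * t\<^sup>2 < 1 \<and> level_fun \<sigma> s t = - k}"
    by (auto simp: cot_Psi_eq_level_fun)
  finally show ?thesis unfolding two_square_less_1_iff by auto
qed

lemma cot_zeros_nonempty: "cot_zeros \<sigma> s k \<noteq> {}"
proof -
  let ?r = "sqrt (1/2) :: real"
  have "\<exists>t\<ge>- ?r. t \<le> ?r \<and> cot_Psi \<sigma> s k t = 0"
  \<comment> \<open>\<open>cot_Psi\<close>, unlike \<open>level_fun\<close>, is continuous up to the
    end points. Its values there are \<open>2 * ?r\<close> and \<open>- 2 * ?r\<close>, whatever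
    \<sigma>, \<open>s\<close> and \<open>k\<close> are.\<close>
  proof (rule IVT2')
    show "continuous_on {- ?r..?r} (cot_Psi \<sigma> s k)"
      unfolding cot_Psi_def[abs_def]
      by (intro continuous_intros) (auto simp: add_nonneg_eq_0_iff)
  qed (auto simp: cot_Psi_def)
  then obtain t where "- ?r \<le> t" "t \<le> ?r" "cot_Psi \<sigma> s k t = 0" by blast
  moreover from this have "2 * t\<^sup>2 < 1 \<or> 2 * t\<^sup>2 = 1"
    unfolding two_square_less_1_iff two_square_eq_1_iff by auto
  ultimately show ?thesis unfolding cot_zeros_def by force
qed

section \<open>Critical points of \<open>level_fun\<close> and root counts\<close>

lemma level_fun_deriv_pos:
  assumes "2 * t\<^sup>2 < 1" "\<sigma> \<le> 0" "s > 0"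
  shows "level_fun_deriv \<sigma> s t > 0"
proof -
  have "(2 + 4 * t\<^sup>2) / (1 - 2 * t\<^sup>2)\<^sup>2 > 0"
    using assms(1) by (intro divide_pos_pos) (auto intro: add_pos_nonneg)
  moreover have "(1 + 2 * t ^ 4) / sqrt ((1 - 2 * t\<^sup>2) * (1 + t\<^sup>2)) ^ 3 \<ge> 0"
    using assms(1) by simp
  then have "2 * \<sigma> * s * ((1 + 2 * t ^ 4) / sqrt ((1 - 2 * t\<^sup>2) * (1 + t\<^sup>2)) ^ 3) \<le> 0"
    using assms by (intro mult_nonpos_nonneg mult_nonneg_nonpos) (auto simp: mult_nonpos_nonneg)
  ultimately show ?thesis unfolding level_fun_deriv_def by linarith
qed

lemma card_cot_zeros_le_Suc:
  assumes "finite {t \<in> {- sqrt (1/2)<..<sqrt (1/2)}. level_fun_deriv \<sigma> s t = 0}"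
  shows "finite (cot_zeros \<sigma> s k)"
    and "card (cot_zeros \<sigma> s k)
      \<le> Suc (card {t \<in> {- sqrt (1/2)<..<sqrt (1/2)}. level_fun_deriv \<sigma> s t = 0})"
proof -
  have d: "(level_fun \<sigma> s has_real_derivative level_fun_deriv \<sigma> s t) (at t)"
    if "- sqrt (1/2) < t" "t < sqrt (1/2)" for t
    using level_fun_has_derivative[of t] that unfolding two_square_less_1_iff by auto
  show "finite (cot_zeros \<sigma> s k)"
    and "card (cot_zeros \<sigma> s k)
      \<le> Suc (card {t \<in> {- sqrt (1/2)<..<sqrt (1/2)}. level_fun_deriv \<sigma> s t = 0})"
    unfolding cot_zeros_eq_level_set
    by (rule card_level_set_le_Suc_card_critical_points[OF d assms]; assumption)+
qed

text \<open>Without critical points Rolle allows at most one root, and the intermediate value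
  theorem supplies one.\<close>

lemma card_cot_zeros_nonpos:
  assumes "\<sigma> \<le> 0" "s > 0"
  shows "finite (cot_zeros \<sigma> s k)" "card (cot_zeros \<sigma> s k) = 1"
proof -
  let ?C = "{t \<in> {- sqrt (1/2)<..<sqrt (1/2)}. level_fun_deriv \<sigma> s t = 0}"
  have C: "?C = {}"
    using level_fun_deriv_pos[OF _ assms] unfolding two_square_less_1_iff by fastforce
  show fin: "finite (cot_zeros \<sigma> s k)"
    by (rule card_cot_zeros_le_Suc(1)) (simp only: C finite.emptyI)
  have "card (cot_zeros \<sigma> s k) \<le> Suc (card ?C)"
    by (rule card_cot_zeros_le_Suc(2)) (simp only: C finite.emptyI)
  then have "card (cot_zeros \<sigma> s k) \<le> 1"
    by (simp only: C card.empty One_nat_def)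
  moreover have "card (cot_zeros \<sigma> s k) \<noteq> 0" using fin cot_zeros_nonempty by simp
  ultimately show "card (cot_zeros \<sigma> s k) = 1" by linarith
qed

text \<open>This is one side of the squared critical-point equation, with \<open>v\<close> standing
  for \<open>t\<^sup>2\<close>. Completing the square shows that the quadratic factor of its
  derivative is at least 3/5.\<close>

lemma critical_quintic_decreasing:
  fixes v w :: real
  assumes "v < w"
  shows "(1 + 2 * w\<^sup>2)\<^sup>2 * (1 - 2 * w) < (1 + 2 * v\<^sup>2)\<^sup>2 * (1 - 2 * v)"
proof (rule DERIV_neg_imp_decreasing[OF assms])
  fix x :: real
  have "10 * x\<^sup>2 - 4 * x + 1 = 10 * (x - 1/5)\<^sup>2 + 3/5"
    by (simp add: power2_eq_square field_simps)
  also have "\<dots> > 0" by (rule add_nonneg_pos) auto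
  finally have "10 * x\<^sup>2 - 4 * x + 1 > 0" .
  then have "- 2 * (1 + 2 * x\<^sup>2) * (10 * x\<^sup>2 - 4 * x + 1) < 0"
    by (intro mult_neg_pos) (auto simp: add_pos_nonneg)
  moreover have "((\<lambda>x. (1 + 2 * x\<^sup>2)\<^sup>2 * (1 - 2 * x)) has_real_derivative
      - 2 * (1 + 2 * x\<^sup>2) * (10 * x\<^sup>2 - 4 * x + 1)) (at x)"
    by (auto intro!: derivative_eq_intros simp: algebra_simps power2_eq_square)
  ultimately show "\<exists>y. ((\<lambda>x. (1 + 2 * x\<^sup>2)\<^sup>2 * (1 - 2 * x)) has_real_derivative y) (at x) \<and> y < 0"
    by blast
qed

text \<open>The condition \<open>level_fun_deriv \<sigma> s t = 0\<close>, squared and freed of denominators.\<close>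

lemma level_fun_deriv_zero_imp:
  assumes "2 * t\<^sup>2 < 1" "level_fun_deriv \<sigma> s t = 0"
  shows "(1 + 2 * t\<^sup>2)\<^sup>2 * (1 + t\<^sup>2) ^ 3 = (\<sigma> * s)\<^sup>2 * ((1 + 2 * (t\<^sup>2)\<^sup>2)\<^sup>2 * (1 - 2 * t\<^sup>2))"
proof -
  let ?D = "1 - 2 * t\<^sup>2" and ?E = "1 + t\<^sup>2"
  define q where "q = sqrt (?D * ?E)"
  have D: "?D > 0" "?E > 0" using assms by (auto intro: add_pos_nonneg)
  then have q: "q > 0" "q\<^sup>2 = ?D * ?E" by (auto simp: q_def)
  have "(2 + 4 * t\<^sup>2) / ?D\<^sup>2 = 2 * \<sigma> * s * ((1 + 2 * t ^ 4) / q ^ 3)"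
    using assms(2) unfolding level_fun_deriv_def q_def by simp
  then have "(2 + 4 * t\<^sup>2) * q ^ 3 = 2 * \<sigma> * s * (1 + 2 * t ^ 4) * ?D\<^sup>2"
    using q(1) D(1) by (simp add: field_simps)
  then have "(1 + 2 * t\<^sup>2) * q ^ 3 = \<sigma> * s * (1 + 2 * t ^ 4) * ?D\<^sup>2"
    by (simp add: algebra_simps)
  then have "((1 + 2 * t\<^sup>2) * q ^ 3)\<^sup>2 = (\<sigma> * s * (1 + 2 * t ^ 4) * ?D\<^sup>2)\<^sup>2" by simp
  moreover have "((1 + 2 * t\<^sup>2) * q ^ 3)\<^sup>2 = (1 + 2 * t\<^sup>2)\<^sup>2 * (q\<^sup>2) ^ 3"
    by (simp add: power_mult_distrib flip: power_mult)
  moreover have "(\<sigma> * s * (1 + 2 * t ^ 4) * ?D\<^sup>2)\<^sup>2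
      = ?D ^ 3 * ((\<sigma> * s)\<^sup>2 * ((1 + 2 * (t\<^sup>2)\<^sup>2)\<^sup>2 * ?D))"
  proof -
    have "(\<sigma> * s * x * d\<^sup>2)\<^sup>2 = d ^ 3 * ((\<sigma> * s)\<^sup>2 * (x\<^sup>2 * d))" for x d :: real
      by (simp add: power_mult_distrib power2_eq_square power3_eq_cube)
    moreover have "t ^ 4 = (t\<^sup>2)\<^sup>2" by simp
    ultimately show ?thesis by (simp only:)
  qed
  \<comment> \<open>Squaring gives \<open>?D ^ 3 * ?E ^ 3\<close> from \<open>q ^ 6\<close> on the
    left and \<open>?D ^ 4\<close> on the right; the common positive factor \<open>?D ^ 3\<close>
    then cancels.\<close>
  ultimately have "?D ^ 3 * ((1 + 2 * t\<^sup>2)\<^sup>2 * ?E ^ 3)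
      = ?D ^ 3 * ((\<sigma> * s)\<^sup>2 * ((1 + 2 * (t\<^sup>2)\<^sup>2)\<^sup>2 * ?D))"
    unfolding q(2) by (simp add: power_mult_distrib mult_ac)
  then show ?thesis using D(1) by simp
qed

text \<open>As functions of \<open>t\<^sup>2\<close>, one side of the squared equation strictly
  increases and the other does not increase, so they agree at most once.\<close>

lemma level_fun_critical_squares_eq:
  assumes "2 * t\<^sup>2 < 1" "level_fun_deriv \<sigma> s t = 0"
    and "2 * u\<^sup>2 < 1" "level_fun_deriv \<sigma> s u = 0"
  shows "t\<^sup>2 = u\<^sup>2"
proof -
  have False if "0 \<le> v" "v < w"
    "(1 + 2 * v)\<^sup>2 * (1 + v) ^ 3 = (\<sigma> * s)\<^sup>2 * ((1 + 2 * v\<^sup>2)\<^sup>2 * (1 - 2 * v))"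
    "(1 + 2 * w)\<^sup>2 * (1 + w) ^ 3 = (\<sigma> * s)\<^sup>2 * ((1 + 2 * w\<^sup>2)\<^sup>2 * (1 - 2 * w))" for v w
  proof -
    have "(1 + 2 * v)\<^sup>2 * (1 + v) ^ 3 < (1 + 2 * w)\<^sup>2 * (1 + w) ^ 3"
      using that by (intro mult_strict_mono power_strict_mono) auto
    \<comment> \<open>Only a weak inequality is available, since \<open>\<sigma> * s\<close> may be
      0.\<close>
    moreover have "(\<sigma> * s)\<^sup>2 * ((1 + 2 * w\<^sup>2)\<^sup>2 * (1 - 2 * w))
        \<le> (\<sigma> * s)\<^sup>2 * ((1 + 2 * v\<^sup>2)\<^sup>2 * (1 - 2 * v))"
      using critical_quintic_decreasing[OF that(2)] by (intro mult_left_mono) auto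
    ultimately show False using that by linarith
  qed
  from this[of "t\<^sup>2" "u\<^sup>2"] this[of "u\<^sup>2" "t\<^sup>2"] show ?thesis
    using level_fun_deriv_zero_imp[OF assms(1,2)] level_fun_deriv_zero_imp[OF assms(3,4)]
    by (metis linorder_neqE zero_le_power2)
qed

lemma card_cot_zeros_le_3:
  shows "finite (cot_zeros \<sigma> s k)" "card (cot_zeros \<sigma> s k) \<le> 3"
proof -
  let ?C = "{t \<in> {- sqrt (1/2)<..<sqrt (1/2)}. level_fun_deriv \<sigma> s t = 0}"
  have "\<exists>u. ?C \<subseteq> {u, - u}"
  proof (cases "?C = {}")
    case False
    then obtain u where u: "u \<in> ?C" by blast
    have "t = u \<or> t = - u" if "t \<in> ?C" for t
      using level_fun_critical_squares_eq[of t \<sigma> s u] that u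
      unfolding two_square_less_1_iff power2_eq_iff by blast
    then show ?thesis by blast
  qed auto
  then obtain u where u: "?C \<subseteq> {u, - u}" by blast
  then have fin: "finite ?C" by (rule finite_subset) auto
  have "card ?C \<le> card {u, - u}" using u by (intro card_mono) auto
  \<comment> \<open>The two candidates coincide when \<open>u = 0\<close>.\<close>
  also have "\<dots> \<le> 2" by (simp add: card_insert_if)
  finally have C: "card ?C \<le> 2" .
  show "finite (cot_zeros \<sigma> s k)" by (rule card_cot_zeros_le_Suc(1)[OF fin])
  have "card (cot_zeros \<sigma> s k) \<le> Suc (card ?C)" by (rule card_cot_zeros_le_Suc(2)[OF fin])
  then show "card (cot_zeros \<sigma> s k) \<le> 3" using C by linarith
qed

section \<open>Passage between angles and cotangents\<close>

lemma one_minus_three_cos_squared: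
  fixes \<beta> :: real
  assumes "sin \<beta> \<noteq> 0"
  shows "1 - 3 * (cos \<beta>)\<^sup>2 = (sin \<beta>)\<^sup>2 * (1 - 2 * (cot \<beta>)\<^sup>2)"
proof -
  have "1 - 3 * (cos \<beta>)\<^sup>2 = (sin \<beta>)\<^sup>2 - 2 * (cos \<beta>)\<^sup>2" by (simp add: cos_squared_eq)
  also have "\<dots> = (sin \<beta>)\<^sup>2 * (1 - 2 * (cot \<beta>)\<^sup>2)"
    using assms by (simp add: cot_def right_diff_distrib power_divide)
  finally show ?thesis .
qed

lemma Psi_eq_cot_Psi:
  assumes "sin \<beta> \<noteq> 0"
  shows "Psi \<sigma> e \<theta> \<beta> = (sin \<beta>)\<^sup>2 *
    cot_Psi \<sigma> (1 / sqrt (1 + e * cos \<theta>)) (e * sin \<theta> / (1 + e * cos \<theta>)) (cot \<beta>)"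
proof -
  note D = one_minus_three_cos_squared[OF assms]
  have "(sin \<beta>)\<^sup>2 * (1 + (cot \<beta>)\<^sup>2) = 1"
    using assms by (simp add: cot_def field_simps)
  then have "(sin \<beta>)\<^sup>2 = 1 / (1 + (cot \<beta>)\<^sup>2)"
    using assms by (metis nonzero_eq_divide_eq mult_zero_right zero_neq_one)
  then have root: "sqrt ((1 - 3 * (cos \<beta>)\<^sup>2) / (1 + e * cos \<theta>))
      = 1 / sqrt (1 + e * cos \<theta>) * sqrt ((1 - 2 * (cot \<beta>)\<^sup>2) / (1 + (cot \<beta>)\<^sup>2))"
    unfolding D by (simp add: real_sqrt_divide real_sqrt_mult)
  have double: "2 * cos \<beta> * sin \<beta> = (sin \<beta>)\<^sup>2 * (2 * cot \<beta>)"
    using assms by (simp add: cot_def power2_eq_square)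
  show ?thesis
    unfolding Psi_def root double unfolding D cot_Psi_def mult.assoc
    unfolding right_diff_distrib[of "(sin \<beta>)\<^sup>2"] by (rule refl)
qed

text \<open>A vanishing sine forces \<open>1 - 3 * (cos \<beta>)\<^sup>2 = - 2\<close>, which the
  domain excludes. Elsewhere the positive factor \<open>(sin \<beta>)\<^sup>2\<close> can be
  cancelled from both the domain condition and the equation.\<close>

lemma Psi_zeros_iff:
  "(\<sigma>, \<beta>) \<in> Psi_zeros e \<theta> \<longleftrightarrow> \<sigma> \<in> {2, 0, -2} \<and> \<beta> \<in> {0..<2 * pi} \<and> sin \<beta> \<noteq> 0 \<and>
    cot \<beta> \<in> cot_zeros \<sigma> (1 / sqrt (1 + e * cos \<theta>)) (e * sin \<theta> / (1 + e * cos \<theta>))"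
proof (cases "sin \<beta> = 0")
  case True
  then have "(cos \<beta>)\<^sup>2 = 1" by (simp add: cos_squared_eq)
  then show ?thesis using True by (simp add: Psi_zeros_def)
next
  case False
  then have "0 \<le> 1 - 3 * (cos \<beta>)\<^sup>2 \<longleftrightarrow> 2 * (cot \<beta>)\<^sup>2 \<le> 1"
    by (simp only: one_minus_three_cos_squared[OF False]) (auto simp: zero_le_mult_iff)
  with False show ?thesis
    unfolding Psi_zeros_def cot_zeros_def by (simp add: Psi_eq_cot_Psi)
qed

text \<open>The two solutions lie in (0, pi) and (pi, 2 pi) and differ by the period pi. The
  condition on the sine matters for \<open>t = 0\<close>: division by zero gives \<open>cot\<close>
  the value 0 at 0 and pi.\<close>

lemma cot_eq_iff_arctan:
  fixes \<beta> t :: real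
  assumes "\<beta> \<in> {0..<2 * pi}"
  shows "sin \<beta> \<noteq> 0 \<and> cot \<beta> = t \<longleftrightarrow> \<beta> = pi / 2 - arctan t \<or> \<beta> = pi / 2 - arctan t + pi"
proof
  assume L: "sin \<beta> \<noteq> 0 \<and> cot \<beta> = t"
  then have "\<beta> \<noteq> 0" "\<beta> \<noteq> pi" by auto
  then consider "0 < \<beta>" "\<beta> < pi" | "pi < \<beta>" "\<beta> < 2 * pi" using assms by fastforce
  then show "\<beta> = pi / 2 - arctan t \<or> \<beta> = pi / 2 - arctan t + pi"
  proof cases
    case 1
    have "arctan t = pi / 2 - \<beta>"
      using 1 L by (intro arctan_unique) (auto simp: tan_def cot_def cos_diff sin_diff)
    then show ?thesis by simp
  next
    case 2
    have "tan (pi / 2 - (\<beta> - pi)) = t"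
      using L unfolding tan_def sin_diff[of "pi / 2"] cos_diff[of "pi / 2"]
      by (auto simp: cot_def)
    then have "arctan t = pi / 2 - (\<beta> - pi)" using 2 by (intro arctan_unique) auto
    then show ?thesis by simp
  qed
next
  have "sin (pi / 2 - arctan t) = cos (arctan t)" "cos (pi / 2 - arctan t) = sin (arctan t)"
    by (simp_all add: sin_diff cos_diff)
  moreover have "cos (arctan t) \<noteq> 0" "sin (arctan t) / cos (arctan t) = t"
    using tan_arctan[of t] by (simp_all add: tan_def)
  ultimately have "sin (pi / 2 - arctan t) \<noteq> 0 \<and> cot (pi / 2 - arctan t) = t"
    by (simp add: cot_def)
  moreover assume "\<beta> = pi / 2 - arctan t \<or> \<beta> = pi / 2 - arctan t + pi"
  ultimately show "sin \<beta> \<noteq> 0 \<and> cot \<beta> = t"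
    by (metis neg_equal_0_iff_equal sin_periodic_pi cos_periodic_pi cot_def
        minus_divide_divide)
qed

lemma card_cot_preimage:
  assumes "finite T"
  defines "B \<equiv> {\<beta> \<in> {0..<2 * pi}. sin \<beta> \<noteq> 0 \<and> cot \<beta> \<in> T}"
  shows "finite B" "card B = 2 * card T"
proof -
  let ?f = "\<lambda>t. pi / 2 - arctan t" and ?g = "\<lambda>t. pi / 2 - arctan t + pi"
  have rng: "0 < ?f t" "?f t < pi" for t
    using arctan_bounded[of t] by auto
  have rng': "?f t \<in> {0..<2 * pi}" "?g t \<in> {0..<2 * pi}" for t
    using rng[of t] by auto
  have B: "B = ?f ` T \<union> ?g ` T"
  proof (rule set_eqI)
    fix \<beta>
    have "\<beta> \<in> B \<longleftrightarrow> \<beta> \<in> {0..<2 * pi} \<and> (\<exists>t\<in>T. sin \<beta> \<noteq> 0 \<and> cot \<beta> = t)"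
      unfolding B_def by auto
    also have "\<dots> \<longleftrightarrow> \<beta> \<in> {0..<2 * pi} \<and> (\<exists>t\<in>T. \<beta> = ?f t \<or> \<beta> = ?g t)"
      using cot_eq_iff_arctan[of \<beta>] by blast
    also have "\<dots> \<longleftrightarrow> \<beta> \<in> ?f ` T \<union> ?g ` T"
      using rng' by blast
    finally show "\<beta> \<in> B \<longleftrightarrow> \<beta> \<in> ?f ` T \<union> ?g ` T" .
  qed
  show "finite B" unfolding B using assms(1) by simp
  have inj: "inj_on ?f T" "inj_on ?g T" by (auto simp: inj_on_def arctan_eq_iff)
  \<comment> \<open>The values of \<open>?f\<close> lie below pi, those of \<open>?g\<close>
    above.\<close>
  have disj: "?f ` T \<inter> ?g ` T = {}"
  proof -
    have "?f t \<noteq> ?g u" for t u using rng[of t] rng[of u] by linarith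
    then show ?thesis by blast
  qed
  show "card B = 2 * card T"
    unfolding B using assms(1) disj inj by (simp add: card_Un_disjoint card_image)
qed

theorem corollary2:
  fixes e \<theta> :: real
  assumes "e \<ge> 0" and "1 + e * cos \<theta> > 0"
  shows "finite (Psi_zeros e \<theta>) \<and> 6 \<le> card (Psi_zeros e \<theta>) \<and> card (Psi_zeros e \<theta>) \<le> 10"
proof -
  define s where "s = 1 / sqrt (1 + e * cos \<theta>)"
  define T where "T \<sigma> = cot_zeros \<sigma> s (e * sin \<theta> / (1 + e * cos \<theta>))" for \<sigma>
  define B where "B \<sigma> = {\<beta> \<in> {0..<2 * pi}. sin \<beta> \<noteq> 0 \<and> cot \<beta> \<in> T \<sigma>}" for \<sigma>
  have s: "s > 0" using assms by (simp add: s_def)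
  have fin: "finite (T \<sigma>)" for \<sigma>
    unfolding T_def by (rule card_cot_zeros_le_3)
  have B: "finite (B \<sigma>)" "card (B \<sigma>) = 2 * card (T \<sigma>)" for \<sigma>
    unfolding B_def using card_cot_preimage[OF fin] by auto
  have Z: "Psi_zeros e \<theta> = Sigma {2, 0, -2} B"
    by (auto simp: Psi_zeros_iff B_def T_def s_def)
  \<comment> \<open>Pairs with different \<sigma> are distinct, so the counts add up even when
    angles coincide; the bounds are 2 (1 + 1 + 1) and 2 (3 + 1 + 1).\<close>
  have "card (Psi_zeros e \<theta>) = 2 * (card (T 2) + card (T 0) + card (T (- 2)))"
    unfolding Z by (subst card_SigmaI) (simp_all add: B)
  moreover have "card (T 0) = 1" "card (T (- 2)) = 1" "card (T 2) \<le> 3"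
    unfolding T_def using s by (simp_all add: card_cot_zeros_nonpos card_cot_zeros_le_3)
  moreover have "card (T 2) \<ge> 1"
    using fin[of 2] cot_zeros_nonempty by (simp add: T_def Suc_le_eq card_gt_0_iff)
  moreover have "finite (Psi_zeros e \<theta>)" unfolding Z using B(1) by auto
  ultimately show ?thesis by simp
qed

end
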